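(* For all integers $0\le k\le n$, the probabilities $r_{k,n}^+=\mathbb{P}\{T_n=k,\,S_n>0\}$ and $r_{k,n}^-=\mathbb{P}\{T_n=k,\,S_n<0\}$ are given by $$r_{k,n}^+=\mathbf{1}_{\mathcal{E}}(n-k)\Bigg[2p\sum_{\substack{i\in\mathcal{E}:\\ n-k\le i\le n-1}}a_i(pq)^{i/2}-4\sum_{\substack{i\in\mathcal{E}:\\ n-k\le i\le n-2}}\bigg(\sum_{\substack{j\in\mathcal{E}:\\ j\le i+k-n}}a_ja_{i-j}\bigg)(pq)^{i/2+1}\Bigg],$$ $$r_{k,n}^-=\mathbf{1}_{\mathcal{E}}(k)\Bigg[2q\sum_{\substack{i\in\mathcal{E}:\\ k\le i\le n-1}}a_i(pq)^{i/2}-4\sum_{\substack{i\in\mathcal{E}:\\ k\le i\le n-2}}\bigg(\sum_{\substack{j\in\mathcal{E}:\\ j\le i-k}}a_ja_{i-j}\bigg)(pq)^{i/2+1}\Bigg].$$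
   Context: Let $p\in(0,1)$, $q=1-p$, and let $(X_k)_{k\ge1}$ be independent random variables with $\mathbb{P}\{X_k=1\}=p$, $\mathbb{P}\{X_k=-1\}=q$. Let $S_0=0$ and $S_k=\sum_{j=1}^kX_j$ for $k\ge1$ (Bernoulli random walk on $\mathbb{Z}$). The modified sojourn time is $T_0=0$ and $T_n=\sum_{j=1}^n\delta_j$ for $n\ge1$, where $\delta_j=1$ if ($S_j>0$) or ($S_j=0$ and $S_{j-1}>0$), and $\delta_j=0$ if ($S_j<0$) or ($S_j=0$ and $S_{j-1}<0$). Notation: $\mathcal{E}=\{0,2,4,\dots\}$, $\mathbf{1}_{\mathcal{E}}$ is its indicator function, and $a_i=\frac{1}{i+2}\binom{i}{i/2}$ for $i\in\mathcal{E}$. Empty sums are $0$. *)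

theory Defs
  imports "HOL-Probability.Probability"
begin

definition walk :: "(nat \<Rightarrow> 'a \<Rightarrow> int) \<Rightarrow> nat \<Rightarrow> 'a \<Rightarrow> int" where
  "walk X k \<omega> = (\<Sum>j = 1..k. X j \<omega>)"

text \<open>
  The first index of \<open>sojourn_step\<close> is meant to be at least 1.
  The \<open>else\<close> branch stands for ``\<open>S\<^sub>j < 0\<close>, or \<open>S\<^sub>j = 0\<close> and \<open>S\<^sub>j\<^sub>-\<^sub>1 < 0\<close>''.  The only other case it covers,
  \<open>S\<^sub>j = S\<^sub>j\<^sub>-\<^sub>1 = 0\<close>, forces \<open>X\<^sub>j = 0\<close>, which has probability 0 for steps
  that are almost surely in \<open>{-1, 1}\<close>.
\<close>

definition sojourn_step :: "(nat \<Rightarrow> 'a \<Rightarrow> int) \<Rightarrow> nat \<Rightarrow> 'a \<Rightarrow> nat" where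
  "sojourn_step X j \<omega> =
     (if walk X j \<omega> > 0 \<or> (walk X j \<omega> = 0 \<and> walk X (j - 1) \<omega> > 0) then 1 else 0)"

definition sojourn :: "(nat \<Rightarrow> 'a \<Rightarrow> int) \<Rightarrow> nat \<Rightarrow> 'a \<Rightarrow> nat" where
  "sojourn X n \<omega> = (\<Sum>j = 1..n. sojourn_step X j \<omega>)"

definition r_plus :: "'a measure \<Rightarrow> (nat \<Rightarrow> 'a \<Rightarrow> int) \<Rightarrow> nat \<Rightarrow> nat \<Rightarrow> real" where
  "r_plus M X k n = measure M {\<omega> \<in> space M. sojourn X n \<omega> = k \<and> walk X n \<omega> > 0}"

definition r_minus :: "'a measure \<Rightarrow> (nat \<Rightarrow> 'a \<Rightarrow> int) \<Rightarrow> nat \<Rightarrow> nat \<Rightarrow> real" where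
  "r_minus M X k n = measure M {\<omega> \<in> space M. sojourn X n \<omega> = k \<and> walk X n \<omega> < 0}"

definition evens :: "nat set" where
  "evens = {i. even i}"

definition a_coeff :: "nat \<Rightarrow> real" where
  "a_coeff i = 1 / (real i + 2) * real (i choose (i div 2))"

end

(* Split a path at its last zero.  By the Chung-Feller theorem the probability of being at 0 after
   i steps above and b steps below the axis (i, b even) is a Catalan number times a power of pq,
   depending on i + b only; the rest of the path stays positive (or negative) and is counted by
   ballot numbers.  The resulting formula for P(S_n = s, T_n = k) satisfies the one-step recursion
   of the walk: away from 0 this is immediate, and at 0 it is Segner's recursion for the Catalan
   numbers, whose convolution sum is split between arrivals from above and from below.  Summing
   over s > 0 (or s < 0) telescopes the ballot probabilities. *)
theory Submission
  imports Defs
begin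

section \<open>Catalan numbers and Segner's recursion\<close>

definition catalan :: "nat \<Rightarrow> real" where
  "catalan m = real ((2 * m) choose m) / real (Suc m)"

text \<open>The absorption identity gives the ratio of the two neighbouring binomials. Their
  difference is what \<open>ballot 1 (Suc m)\<close> unfolds to.\<close>

lemma catalan_eq_diff: "catalan (Suc m) = real ((2 * m + 2) choose Suc m) - real ((2 * m + 2) choose m)"
proof -
  have "Suc (m + 1) * ((2 * m + 2) choose Suc (m + 1)) = (2 * m + 2 - (m + 1)) * ((2 * m + 2) choose (m + 1))"
    using binomial_absorb_comp[of "2 * m + 2" "m + 1"] binomial_absorption[of "m+1" "2*m+2"]
    by (simp add: mult.commute)
  moreover have "(2 * m + 2) choose Suc (m + 1) = (2 * m + 2) choose m"
    using binomial_symmetric[of m "2 * m + 2"] by simp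
  ultimately have "(m + 2) * ((2 * m + 2) choose m) = (m + 1) * ((2 * m + 2) choose Suc m)"
    by simp
  then have "real (m + 2) * real ((2 * m + 2) choose m) = real (m + 1) * real ((2 * m + 2) choose Suc m)"
    by (metis of_nat_mult)
  then show ?thesis
    by (simp add: catalan_def field_simps)
qed

lemma catalan_Suc: "real (m + 2) * catalan (Suc m) = real (4 * m + 2) * catalan m"
proof -
  have "Suc m * ((2 * m + 2) choose Suc m) = Suc m * (2 * ((2 * m + 1) choose m))"
    using Suc_times_binomial[of m "2 * m + 1"] by simp
  then have A: "(2 * m + 2) choose Suc m = 2 * ((2 * m + 1) choose m)"
    by (simp only: Suc_mult_cancel1)
  have "Suc m * ((2 * m + 1) choose m) = Suc (2 * m) * ((2 * m) choose m)"
    using Suc_times_binomial_add[of m m] Suc_times_binomial[of m "2*m"]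
      binomial_symmetric[of m "2 * m + 1"] by (simp add: mult_2)
  then have "real (Suc m) * real ((2 * m + 1) choose m) = real (Suc (2 * m)) * real ((2 * m) choose m)"
    by (metis of_nat_mult)
  with A show ?thesis
    by (simp add: catalan_def field_simps)
qed

text \<open>Multiplying the convolution by its index and symmetrising turns the first-order recurrence
  of the Catalan numbers into one for their convolution square.\<close>

lemma catalan_convolution: "(\<Sum>i\<le>m. catalan i * catalan (m - i)) = catalan (Suc m)"
proof (induction m)
  case 0
  show ?case by (simp add: catalan_def)
next
  case (Suc m)
  define S where "S m = (\<Sum>i\<le>m. catalan i * catalan (m - i))" for m
  define T where "T m = (\<Sum>i\<le>m. real i * (catalan i * catalan (m - i)))" for m
  have T: "2 * T m = real m * S m" for m
  proof -
    have *: "T m = (\<Sum>i\<le>m. real (m - i) * (catalan i * catalan (m - i)))"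
      unfolding T_def by (rule sum.reindex_bij_witness[of _ "\<lambda>i. m - i" "\<lambda>i. m - i"]) auto
    have "2 * T m = T m + T m"
      by simp
    also have "\<dots> = (\<Sum>i\<le>m. (real i + real (m - i)) * (catalan i * catalan (m - i)))"
      by (subst (2) *) (simp only: T_def sum.distrib distrib_right)
    also have "\<dots> = real m * S m"
      unfolding S_def sum_distrib_left by (rule sum.cong) (auto simp: of_nat_diff)
    finally show ?thesis .
  qed
  \<comment> \<open>The weight \<open>i + 1\<close> becomes \<open>i + 2\<close> after the index
    shift, which is the factor that \<open>catalan_Suc\<close> absorbs.\<close>
  have "T (Suc m) + S (Suc m) = (\<Sum>i\<le>Suc m. real (i + 1) * catalan i * catalan (Suc m - i))"
    by (simp only: T_def S_def sum.distrib[symmetric]) (simp add: algebra_simps)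
  also have "\<dots> = catalan (Suc m) + (\<Sum>i\<le>m. real (i + 2) * catalan (Suc i) * catalan (m - i))"
    by (subst sum.atMost_Suc_shift) (simp add: catalan_def[of 0])
  also have "(\<Sum>i\<le>m. real (i + 2) * catalan (Suc i) * catalan (m - i)) = 4 * T m + 2 * S m"
    unfolding catalan_Suc T_def S_def sum_distrib_left sum.distrib[symmetric]
    by (rule sum.cong) (auto simp: algebra_simps)
  \<comment> \<open>Symmetrisation removes the weighted sums \<open>T\<close>, leaving a recurrence
    for \<open>S\<close> alone.\<close>
  finally have "real (m + 3) * S (Suc m) = 2 * catalan (Suc m) + real (4 * m + 4) * S m"
    using T[of m] T[of "Suc m"] by (simp add: algebra_simps)
  also have "S m = catalan (Suc m)"
    using Suc.IH by (simp add: S_def)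
  also have "2 * catalan (Suc m) + real (4 * m + 4) * catalan (Suc m) = real (m + 3) * catalan (Suc (Suc m))"
    using catalan_Suc[of "Suc m"] by (simp add: algebra_simps)
  finally show ?case
    by (simp add: S_def)
qed

section \<open>Paths that stay positive: ballot numbers and Dyck paths\<close>

text \<open>\<open>ballot s j\<close> counts the paths from \<open>0\<close> to \<open>s\<close> with \<open>j\<close> down-steps that stay positive
  after time \<open>0\<close>; the difference of binomials comes from the reflection principle.\<close>

definition ballot :: "nat \<Rightarrow> nat \<Rightarrow> real" where
  "ballot s j = (case j of 0 \<Rightarrow> 1 | Suc i \<Rightarrow> real ((s + 2 * i + 1) choose Suc i) - real ((s + 2 * i + 1) choose i))"

text \<open>This is the boundary condition: a path that stays positive after time 0 cannot come back
  to 0.\<close>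

lemma ballot_0_Suc: "ballot 0 (Suc j) = 0"
  using binomial_symmetric[of j "2 * j + 1"] by (simp add: ballot_def)

lemma ballot_0_right [simp]: "ballot s 0 = 1"
  by (simp add: ballot_def)

text \<open>Split by the last step: up from \<open>s\<close>, or down from \<open>s + 2\<close> with
  one down-step fewer before it. On the binomials this is Pascal's rule.\<close>

lemma ballot_Suc_Suc: "ballot (Suc s) (Suc j) = ballot s (Suc j) + ballot (s + 2) j"
  by (cases j) (simp_all add: ballot_def)

lemma ballot_1: "ballot 1 j = catalan j"
  by (cases j) (simp_all add: ballot_def catalan_eq_diff, simp add: catalan_def)

text \<open>\<open>pos_path p q s r\<close> is the probability that the walk is at \<open>s\<close> at time \<open>r\<close> and is
  positive at the times \<open>1, \<dots>, r\<close>.\<close>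

fun pos_path :: "real \<Rightarrow> real \<Rightarrow> nat \<Rightarrow> nat \<Rightarrow> real" where
  "pos_path p q s 0 = (if s = 0 then 1 else 0)"
| "pos_path p q 0 (Suc r) = 0"
| "pos_path p q (Suc s) (Suc r) = p * pos_path p q s r + q * pos_path p q (s + 2) r"

lemma pos_path_eq_0: "odd (r + s) \<or> r < s \<Longrightarrow> pos_path p q s r = 0"
  by (induction p q s r rule: pos_path.induct) (auto intro: odd_pos)

lemma pos_path_ballot: "pos_path p q s (s + 2 * j) = ballot s j * p ^ (s + j) * q ^ j"
\<comment> \<open>The induction is on time, because the recursion of \<open>pos_path\<close> also
  refers to the higher site \<open>s + 2\<close>.\<close>
proof (induction "s + 2 * j" arbitrary: s j)
  case 0
  then show ?case by simp
next
  case (Suc r)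
  show ?case
  proof (cases s)
    case 0
    with Suc.hyps(2) obtain i where "j = Suc i" by (cases j) auto
    with 0 show ?thesis by (simp add: ballot_0_Suc)
  next
    case s: (Suc s')
    have 1: "pos_path p q s' (s' + 2 * j) = ballot s' j * p ^ (s' + j) * q ^ j"
      using Suc.hyps s by simp
    show ?thesis
    proof (cases j)
      case 0
      \<comment> \<open>Without down-steps the site \<open>s' + 2\<close> is out of reach at time
        \<open>s'\<close>.\<close>
      with s 1 show ?thesis by (simp add: pos_path_eq_0)
    next
      case j: (Suc i)
      have "pos_path p q (s' + 2) ((s' + 2) + 2 * i) = ballot (s' + 2) i * p ^ (s' + 2 + i) * q ^ i"
        by (rule Suc.hyps(1)) (use Suc.hyps(2) s j in simp)
      with s j 1 show ?thesis by (simp add: ballot_Suc_Suc algebra_simps)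
    qed
  qed
qed

text \<open>For \<open>x = p * q\<close> this is the probability of a Dyck path: the walk is at 0
  after \<open>r\<close> steps and has never been below 0.\<close>

definition cat_weight :: "real \<Rightarrow> nat \<Rightarrow> real" where
  "cat_weight x r = (if even r then catalan (r div 2) * x ^ (r div 2) else 0)"

lemma pos_path_1: "pos_path p q 1 (Suc r) = p * cat_weight (p * q) r"
proof (cases "even r")
  case True
  then obtain j where "r = 2 * j" by blast
  with pos_path_ballot[of p q 1 j] show ?thesis
    by (simp add: cat_weight_def ballot_1[unfolded One_nat_def] power_mult_distrib)
qed (simp add: cat_weight_def pos_path_eq_0 del: pos_path.simps)

lemma sum_atMost_double:
  fixes f :: "nat \<Rightarrow> real"
  assumes "\<And>i. odd i \<Longrightarrow> f i = 0"
  shows "(\<Sum>i\<le>2 * m. f i) = (\<Sum>i\<le>m. f (2 * i))"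
  using assms by (induction m) auto

text \<open>Segner's recursion with weights; the factor \<open>x\<close> supplies the power by which
  the degree rises.\<close>

lemma cat_weight_convolution:
  "x * (\<Sum>i\<le>r. cat_weight x i * cat_weight x (r - i)) = cat_weight x (r + 2)"
proof (cases "even r")
  case True
  then obtain m where r: "r = 2 * m" by blast
  have "(\<Sum>i\<le>r. cat_weight x i * cat_weight x (r - i)) =
      (\<Sum>i\<le>m. cat_weight x (2 * i) * cat_weight x (r - 2 * i))"
    unfolding r by (rule sum_atMost_double) (simp add: cat_weight_def)
  also have "\<dots> = (\<Sum>i\<le>m. catalan i * catalan (m - i) * x ^ m)"
    by (rule sum.cong)
      (auto simp: cat_weight_def r mult.assoc mult.left_commute simp flip: right_diff_distrib' power_add)
  also have "\<dots> = catalan (Suc m) * x ^ m"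
    by (simp add: catalan_convolution flip: sum_distrib_right)
  finally show ?thesis by (simp add: cat_weight_def r)
next
  case False
  then have "(\<Sum>i\<le>r. cat_weight x i * cat_weight x (r - i)) = 0"
    by (intro sum.neutral) (auto simp: cat_weight_def)
  with False show ?thesis by (simp add: cat_weight_def)
qed

section \<open>Decomposition at the last zero\<close>

text \<open>By the Chung--Feller theorem this is the probability of being at \<open>0\<close> after \<open>a\<close> steps
  above and \<open>b\<close> steps below the axis.\<close>

definition bridge :: "real \<Rightarrow> nat \<Rightarrow> nat \<Rightarrow> real" where
  "bridge x a b = (if even a \<and> even b then cat_weight x (a + b) else 0)"

lemma bridge_commute: "bridge x a b = bridge x b a"
  by (simp add: bridge_def add.commute)

text \<open>Decomposition of a path at its last zero, which occurs after \<open>i\<close> steps above the axis.\<close>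

definition path_weight :: "real \<Rightarrow> real \<Rightarrow> nat \<Rightarrow> nat \<Rightarrow> nat \<Rightarrow> real" where
  "path_weight p q a b s = (\<Sum>i\<le>a. bridge (p * q) i b * pos_path p q s (a - i))"

lemma path_weight_0: "path_weight p q a b 0 = bridge (p * q) a b"
proof -
  have *: "pos_path p q 0 (a - i) = (if i = a then 1 else 0)" if "i \<le> a" for i
    using that by (cases "a - i") auto
  have "path_weight p q a b 0 = (\<Sum>i\<le>a. if i = a then bridge (p * q) a b else 0)"
    unfolding path_weight_def by (rule sum.cong) (simp_all add: *)
  then show ?thesis by simp
qed

lemma path_weight_0_Suc: "path_weight p q 0 b (Suc s) = 0"
  by (simp add: path_weight_def)

text \<open>The summand whose last zero is the end point vanishes, as \<open>Suc s\<close> is not 0;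
  the recursion of \<open>pos_path\<close> applies to all the others.\<close>

lemma path_weight_Suc_Suc:
  "path_weight p q (Suc a) b (Suc s) = p * path_weight p q a b s + q * path_weight p q a b (s + 2)"
proof -
  have "path_weight p q (Suc a) b (Suc s) = (\<Sum>i\<le>a. bridge (p * q) i b * pos_path p q (Suc s) (Suc (a - i)))"
    by (auto simp: path_weight_def Suc_diff_le simp del: pos_path.simps(2-) intro!: sum.cong)
  then show ?thesis
    by (simp add: path_weight_def sum_distrib_left sum.distrib distrib_left mult.left_commute)
qed

text \<open>The left side is the mass that steps down from 1 to 0. As a partial convolution it can
  be joined with the mass arriving from below.\<close>

lemma path_weight_1:
  "q * path_weight p q (Suc a) b 1 =
    p * q * (\<Sum>i\<le>a. bridge (p * q) i b * cat_weight (p * q) (a - i))"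
proof -
  have "path_weight p q (Suc a) b 1 = (\<Sum>i\<le>a. bridge (p * q) i b * pos_path p q 1 (Suc (a - i)))"
    by (auto simp: path_weight_def Suc_diff_le simp del: pos_path.simps(2-) intro!: sum.cong)
  also have "\<dots> = p * (\<Sum>i\<le>a. bridge (p * q) i b * cat_weight (p * q) (a - i))"
    unfolding pos_path_1 by (simp add: sum_distrib_left mult.left_commute)
  finally show ?thesis by simp
qed

lemma path_weight_0_1: "path_weight p q 0 b 1 = 0"
  by (simp add: path_weight_def)

text \<open>The two summands are complementary parts of the convolution of \<open>cat_weight\<close> with itself.\<close>

lemma bridge_last_step:
  assumes "a + b \<noteq> 0"
  shows "bridge (p * q) a b =
    (if a = 0 then 0 else q * path_weight p q (a - 1) b 1) +
    (if b = 0 then 0 else p * path_weight q p (b - 1) a 1)"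
proof (cases "even a \<and> even b")
  case False
  have *: "y * path_weight x y (a - 1) b 1 = 0" if "odd a \<or> odd b" for a b x y
  proof (cases "a \<ge> 2")
    case True
    then obtain a' where a: "a = Suc (Suc a')" by (metis add_2_eq_Suc le_Suc_ex)
    \<comment> \<open>Either an argument of \<open>bridge\<close> is odd, or \<open>a' - i\<close>
      is.\<close>
    have "bridge (x * y) i b * cat_weight (x * y) (a' - i) = 0" if "i \<le> a'" for i
      using that \<open>odd a \<or> odd b\<close> a by (auto simp: bridge_def cat_weight_def)
    then have "(\<Sum>i\<le>a'. bridge (x * y) i b * cat_weight (x * y) (a' - i)) = 0"
      by (intro sum.neutral) simp
    then show ?thesis by (simp add: a path_weight_1[unfolded One_nat_def])
  next
    case False
    \<comment> \<open>Truncation makes this cover \<open>a = 0\<close> as well as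
      \<open>a = 1\<close>; with no step above the axis, 1 is not reached.\<close>
    then have "a - 1 = 0" by simp
    then show ?thesis by (simp only: path_weight_0_1)
  qed
  have "bridge (p * q) a b = 0" unfolding bridge_def using False by argo
  moreover have "q * path_weight p q (a - 1) b 1 = 0" "p * path_weight q p (b - 1) a 1 = 0"
    by (rule *; use False in blast)+
  ultimately show ?thesis by auto
next
  case True
  let ?d = "cat_weight (p * q)"
  \<comment> \<open>The substitution \<open>l = i + b\<close> shows which indices of the full
    convolution belong to arrivals from above. Exchanging the roles of the variables covers arrivals
    from below.\<close>
  have *: "(if a = 0 then 0 else y * path_weight x y (a - 1) b 1) =
      x * y * (\<Sum>l\<in>{l. b \<le> l \<and> l + 2 \<le> a + b}. cat_weight (x * y) l * cat_weight (x * y) (a + b - 2 - l))"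
    if "even a" "even b" for a b x y
  proof (cases "a = 0")
    case True
    then have "{l. b \<le> l \<and> l + 2 \<le> a + b} = {}" by auto
    with True show ?thesis by (simp only: simp_thms if_True sum.empty mult_zero_right)
  next
    case False
    moreover obtain c where "a = 2 * c" using \<open>even a\<close> by blast
    ultimately obtain c' where "a = 2 * Suc c'" by (cases c) auto
    then obtain a' where a: "a = Suc (Suc a')" "even a'" by simp
    have "(\<Sum>i\<le>a'. bridge (x * y) i b * cat_weight (x * y) (a' - i)) =
        (\<Sum>i\<le>a'. cat_weight (x * y) (i + b) * cat_weight (x * y) (a' - i))"
      by (rule sum.cong) (use that in \<open>auto simp: bridge_def cat_weight_def\<close>)
    also have "\<dots> = (\<Sum>l\<in>{l. b \<le> l \<and> l + 2 \<le> a + b}. cat_weight (x * y) l * cat_weight (x * y) (a + b - 2 - l))"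
      by (rule sum.reindex_bij_witness[of _ "\<lambda>l. l - b" "\<lambda>i. i + b"]) (auto simp: a)
    finally show ?thesis by (simp add: path_weight_1[unfolded One_nat_def] a)
  qed
  define N where "N = a + b - 2"
  have N: "a + b = N + 2"
    using assms True unfolding N_def by (auto elim!: evenE)
  \<comment> \<open>The reflection \<open>N - l\<close> moves the arrivals from below to the lower
    end of the index range.\<close>
  have "(\<Sum>l\<in>{l. a \<le> l \<and> l + 2 \<le> b + a}. ?d l * ?d (b + a - 2 - l)) = (\<Sum>l\<in>{l. l + 2 \<le> b}. ?d l * ?d (N - l))"
    by (rule sum.reindex_bij_witness[of _ "\<lambda>l. N - l" "\<lambda>l. N - l"])
      (use N in \<open>auto simp: add.commute[of b a]\<close>)
  \<comment> \<open>The only index that can be new is \<open>l = b - 1\<close>, which is odd because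
    \<open>b\<close> is even, so its weight is 0.\<close>
  also have "\<dots> = (\<Sum>l\<in>{l. l < b \<and> l \<le> N}. ?d l * ?d (N - l))"
  proof (rule sum.mono_neutral_left)
    show "\<forall>i\<in>{l. l < b \<and> l \<le> N} - {l. l + 2 \<le> b}. ?d i * ?d (N - i) = 0"
    proof
      fix i assume "i \<in> {l. l < b \<and> l \<le> N} - {l. l + 2 \<le> b}"
      then have "b = Suc i" by auto
      with True have "odd i" by simp
      then show "?d i * ?d (N - i) = 0" by (simp add: cat_weight_def)
    qed
  qed (use N in auto)
  finally have 2: "(\<Sum>l\<in>{l. a \<le> l \<and> l + 2 \<le> b + a}. ?d l * ?d (b + a - 2 - l)) =
      (\<Sum>l\<in>{l. l < b \<and> l \<le> N}. ?d l * ?d (N - l))" .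
  have 1: "(\<Sum>l\<in>{l. b \<le> l \<and> l + 2 \<le> a + b}. ?d l * ?d (a + b - 2 - l)) =
      (\<Sum>l\<in>{l. b \<le> l \<and> l \<le> N}. ?d l * ?d (N - l))"
    by (rule sum.cong) (use N in auto)
  have "bridge (p * q) a b = ?d (N + 2)"
    using True N by (simp add: bridge_def)
  also have "\<dots> = p * q * (\<Sum>l\<le>N. ?d l * ?d (N - l))"
    by (simp add: cat_weight_convolution)
  also have "{..N} = {l. b \<le> l \<and> l \<le> N} \<union> {l. l < b \<and> l \<le> N}"
    by auto
  also have "(\<Sum>l\<in>\<dots>. ?d l * ?d (N - l)) =
      (\<Sum>l\<in>{l. b \<le> l \<and> l \<le> N}. ?d l * ?d (N - l)) + (\<Sum>l\<in>{l. l < b \<and> l \<le> N}. ?d l * ?d (N - l))"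
    by (rule sum.union_disjoint) auto
  finally show ?thesis
    using *[of a b q p] *[of b a p q] True 1 2 by (simp add: mult.commute[of q p] distrib_left)
qed

section \<open>Summation over the end point\<close>

text \<open>The probability of staying positive is \<open>p\<close> after the first step. As
  \<open>p + q = 1\<close>, each further step loses only the mass that moves from 1 to 0, and
  \<open>pos_path_1\<close> evaluates this loss.\<close>

lemma sum_pos_path:
  assumes "q = 1 - p"
  shows "(\<Sum>s=1..Suc r. pos_path p q s (Suc r)) = p - p * q * (\<Sum>j<r. cat_weight (p * q) j)"
proof (induction r)
  case 0
  show ?case by simp
next
  case (Suc r)
  let ?h = "\<lambda>s. pos_path p q s (Suc r)"
  have "(\<Sum>s=1..Suc (Suc r). pos_path p q s (Suc (Suc r))) = (\<Sum>s\<le>Suc r. pos_path p q (Suc s) (Suc (Suc r)))"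
    by (rule sum.reindex_bij_witness[of _ Suc "\<lambda>s. s - 1"]) auto
  also have "\<dots> = p * (\<Sum>s\<le>Suc r. ?h s) + q * (\<Sum>s\<le>Suc r. ?h (s + 2))"
    by (simp only: pos_path.simps sum.distrib sum_distrib_left)
  also have "(\<Sum>s\<le>Suc r. ?h s) = (\<Sum>s=1..Suc r. ?h s)"
    by (rule sum.mono_neutral_right) (auto simp: not_less_eq_eq)
  also have "(\<Sum>s\<le>Suc r. ?h (s + 2)) = (\<Sum>s\<in>{2..r + 3}. ?h s)"
    by (rule sum.reindex_bij_witness[of _ "\<lambda>s. s - 2" "\<lambda>s. s + 2"]) auto
  also have "\<dots> = (\<Sum>s\<in>{2..Suc r}. ?h s)"
    by (rule sum.mono_neutral_right) (auto intro!: pos_path_eq_0)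
  also have "\<dots> = (\<Sum>s=1..Suc r. ?h s) - ?h 1"
    using sum.atLeast_Suc_atMost[of 1 "Suc r" ?h] by (simp add: numeral_2_eq_2 del: pos_path.simps sum.cl_ivl_Suc)
  also have "?h 1 = p * cat_weight (p * q) r"
    by (rule pos_path_1)
  finally show ?case
    unfolding Suc.IH by (simp add: assms algebra_simps del: pos_path.simps)
qed

text \<open>For \<open>r = 2 * m\<close>, \<open>1 / (r + 2)\<close> is half of
  \<open>1 / (m + 1)\<close>. This is the source of the constants 2 and, for products of two
  weights, 4.\<close>

lemma cat_weight_eq_a_coeff:
  "cat_weight x r = (if r \<in> evens then 2 * a_coeff r * x ^ (r div 2) else 0)"
  by (auto simp: cat_weight_def evens_def a_coeff_def catalan_def field_simps elim!: evenE)

lemma sum_path_weight_last_zero: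
  assumes "q = 1 - p"
  shows "(\<Sum>s=1..a + b. path_weight p q a b s) =
    (\<Sum>i<a. bridge (p * q) i b * (p - p * q * (\<Sum>j<a - i - 1. cat_weight (p * q) j)))"
proof -
  have "(\<Sum>s=1..a + b. path_weight p q a b s) =
      (\<Sum>i\<le>a. bridge (p * q) i b * (\<Sum>s=1..a + b. pos_path p q s (a - i)))"
    unfolding path_weight_def sum_distrib_left by (rule sum.swap)
  \<comment> \<open>The summand \<open>i = a\<close> drops out: with no time left after the last
    zero the end point is 0.\<close>
  also have "\<dots> = (\<Sum>i<a. bridge (p * q) i b * (\<Sum>s=1..a + b. pos_path p q s (a - i)))"
    by (simp add: lessThan_Suc_atMost[symmetric])
  also have "\<dots> = (\<Sum>i<a. bridge (p * q) i b * (p - p * q * (\<Sum>j<a - i - 1. cat_weight (p * q) j)))"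
  proof (rule sum.cong)
    fix i assume "i \<in> {..<a}"
    then obtain r where r: "a - i = Suc r" by (metis Suc_diff_Suc lessThan_iff)
    have "(\<Sum>s=1..a + b. pos_path p q s (a - i)) = (\<Sum>s=1..Suc r. pos_path p q s (Suc r))"
      unfolding r by (rule sum.mono_neutral_right) (use r in \<open>auto intro!: pos_path_eq_0\<close>)
    with sum_pos_path[OF assms, of r] r show "bridge (p * q) i b * (\<Sum>s=1..a + b. pos_path p q s (a - i)) =
        bridge (p * q) i b * (p - p * q * (\<Sum>j<a - i - 1. cat_weight (p * q) j))"
      by simp
  qed simp
  finally show ?thesis .
qed

text \<open>This serves both claims: \<open>a = k\<close> and \<open>b = n - k\<close> for a
  positive end point, and the reflected choice with \<open>p\<close> and \<open>q\<close> exchanged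
  for a negative one.\<close>

lemma sum_path_weight:
  assumes "q = 1 - p" and n: "n = a + b"
  shows "(\<Sum>s=1..n. path_weight p q a b s) =
    indicator evens b *
      (2 * p * (\<Sum>i\<in>{i\<in>evens. b \<le> i \<and> i + 1 \<le> n}. a_coeff i * (p * q) ^ (i div 2))
       - 4 * (\<Sum>i\<in>{i\<in>evens. b \<le> i \<and> i + 2 \<le> n}.
           (\<Sum>j\<in>{j\<in>evens. j + b \<le> i}. a_coeff j * a_coeff (i - j)) * (p * q) ^ (i div 2 + 1)))"
proof (cases "b \<in> evens")
  case False
  then have "bridge (p * q) i b = 0" for i
    by (auto simp: bridge_def evens_def)
  with False show ?thesis
    by (simp add: path_weight_def)
next
  case True
  let ?d = "cat_weight (p * q)"
  have bridge: "bridge (p * q) i b = ?d (i + b)" for i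
    using True by (auto simp: bridge_def evens_def cat_weight_def)
  have "(\<Sum>i<a. ?d (i + b)) = (\<Sum>i\<in>{i. b \<le> i \<and> i + 1 \<le> n}. ?d i)"
    by (rule sum.reindex_bij_witness[of _ "\<lambda>i. i - b" "\<lambda>i. i + b"]) (auto simp: n)
  also have "\<dots> = (\<Sum>i\<in>{i\<in>evens. b \<le> i \<and> i + 1 \<le> n}. ?d i)"
    by (rule sum.mono_neutral_right) (auto simp: cat_weight_eq_a_coeff intro: finite_subset[of _ "{..n}"])
  also have "\<dots> = 2 * (\<Sum>i\<in>{i\<in>evens. b \<le> i \<and> i + 1 \<le> n}. a_coeff i * (p * q) ^ (i div 2))"
    by (simp add: cat_weight_eq_a_coeff sum_distrib_left mult.assoc)
  finally have 1: "(\<Sum>i<a. ?d (i + b)) =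
      2 * (\<Sum>i\<in>{i\<in>evens. b \<le> i \<and> i + 1 \<le> n}. a_coeff i * (p * q) ^ (i div 2))" .
  \<comment> \<open>Only even \<open>j\<close> and \<open>i - j\<close> contribute, and then their
    halves add up to \<open>i div 2\<close>.\<close>
  have inner: "(\<Sum>j\<in>{j. j + b \<le> i}. ?d (i - j) * ?d j) * (p * q) =
      (if i \<in> evens then 4 * ((\<Sum>j\<in>{j\<in>evens. j + b \<le> i}. a_coeff j * a_coeff (i - j)) * (p * q) ^ (i div 2 + 1)) else 0)"
    for i
  proof (cases "i \<in> evens")
    case i: True
    have fin: "finite {j. j + b \<le> i}" by (rule finite_subset[of _ "{..i}"]) auto
    have "(\<Sum>j\<in>{j. j + b \<le> i}. ?d (i - j) * ?d j) = (\<Sum>j\<in>{j\<in>evens. j + b \<le> i}. ?d (i - j) * ?d j)"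
      by (rule sum.mono_neutral_right) (auto simp: cat_weight_eq_a_coeff fin)
    also have "\<dots> = (\<Sum>j\<in>{j\<in>evens. j + b \<le> i}. 4 * (a_coeff j * a_coeff (i - j) * (p * q) ^ (i div 2)))"
    proof (rule sum.cong)
      fix j assume "j \<in> {j\<in>evens. j + b \<le> i}"
      with i obtain u v where "j = 2 * u" "i = 2 * v" "u \<le> v"
        by (auto simp: evens_def elim!: evenE)
      then obtain w where "j = 2 * u" "i = 2 * u + 2 * w"
        by (metis le_Suc_ex distrib_left)
      then show "?d (i - j) * ?d j = 4 * (a_coeff j * a_coeff (i - j) * (p * q) ^ (i div 2))"
        by (simp add: cat_weight_eq_a_coeff evens_def power_add)
    qed simp
    finally show ?thesis
      using i by (simp add: sum_distrib_left sum_distrib_right mult_ac)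
  next
    case False
    then have "?d (i - j) * ?d j = 0" if "j + b \<le> i" for j
      using that by (auto simp: cat_weight_def evens_def)
    then have "(\<Sum>j\<in>{j. j + b \<le> i}. ?d (i - j) * ?d j) = 0"
      by (intro sum.neutral) simp
    with False show ?thesis by simp
  qed
  have "(\<Sum>i<a. ?d (i + b) * (\<Sum>j<a - i - 1. ?d j)) =
      (\<Sum>(i, j)\<in>Sigma {..<a} (\<lambda>i. {..<a - i - 1}). ?d (i + b) * ?d j)"
    by (simp add: sum_distrib_left sum.Sigma)
  \<comment> \<open>The new outer index is the total \<open>i + b + j\<close> of both weights;
    \<open>j < a - i - 1\<close> turns into the bound by \<open>n - 2\<close>.\<close>
  also have "\<dots> = (\<Sum>(i, j)\<in>Sigma {i. b \<le> i \<and> i + 2 \<le> n} (\<lambda>i. {j. j + b \<le> i}). ?d (i - j) * ?d j)"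
    by (rule sum.reindex_bij_witness[of _ "\<lambda>(i, j). (i - j - b, j)" "\<lambda>(i, j). (i + b + j, j)"])
      (auto simp: n)
  also have "\<dots> = (\<Sum>i\<in>{i. b \<le> i \<and> i + 2 \<le> n}. \<Sum>j\<in>{j. j + b \<le> i}. ?d (i - j) * ?d j)"
  proof (rule sum.Sigma[symmetric])
    show "finite {i. b \<le> i \<and> i + 2 \<le> n}" by (rule finite_subset[of _ "{..n}"]) auto
    show "\<forall>i\<in>{i. b \<le> i \<and> i + 2 \<le> n}. finite {j. j + b \<le> i}"
      by (intro ballI, rule finite_subset[of _ "{..n}"]) auto
  qed
  finally have "p * q * (\<Sum>i<a. ?d (i + b) * (\<Sum>j<a - i - 1. ?d j)) =
      (\<Sum>i\<in>{i. b \<le> i \<and> i + 2 \<le> n}. (\<Sum>j\<in>{j. j + b \<le> i}. ?d (i - j) * ?d j) * (p * q))"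
    by (simp add: sum_distrib_left mult.commute)
  also have "\<dots> = (\<Sum>i\<in>{i\<in>evens. b \<le> i \<and> i + 2 \<le> n}.
      4 * ((\<Sum>j\<in>{j\<in>evens. j + b \<le> i}. a_coeff j * a_coeff (i - j)) * (p * q) ^ (i div 2 + 1)))"
    unfolding inner
    by (rule sum.mono_neutral_cong_right) (auto intro: finite_subset[of _ "{..n}"])
  finally have 2: "p * q * (\<Sum>i<a. ?d (i + b) * (\<Sum>j<a - i - 1. ?d j)) =
      4 * (\<Sum>i\<in>{i\<in>evens. b \<le> i \<and> i + 2 \<le> n}.
        (\<Sum>j\<in>{j\<in>evens. j + b \<le> i}. a_coeff j * a_coeff (i - j)) * (p * q) ^ (i div 2 + 1))"
    by (simp add: sum_distrib_left)
  have "(\<Sum>s=1..n. path_weight p q a b s) =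
      p * (\<Sum>i<a. ?d (i + b)) - p * q * (\<Sum>i<a. ?d (i + b) * (\<Sum>j<a - i - 1. ?d j))"
    unfolding n sum_path_weight_last_zero[OF assms(1)] bridge
    by (simp add: right_diff_distrib sum_subtractf sum_distrib_left mult_ac)
  also have "\<dots> = p * (2 * (\<Sum>i\<in>{i\<in>evens. b \<le> i \<and> i + 1 \<le> n}. a_coeff i * (p * q) ^ (i div 2))) -
      4 * (\<Sum>i\<in>{i\<in>evens. b \<le> i \<and> i + 2 \<le> n}.
        (\<Sum>j\<in>{j\<in>evens. j + b \<le> i}. a_coeff j * a_coeff (i - j)) * (p * q) ^ (i div 2 + 1))"
    by (simp only: 1 2)
  finally show ?thesis
    using True by simp
qed

section \<open>Walk and sojourn time as functions of the first \<open>n\<close> steps\<close>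

lemma walk_Suc: "walk X (Suc n) \<omega> = walk X n \<omega> + X (Suc n) \<omega>"
  by (simp add: walk_def)

lemma sojourn_Suc: "sojourn X (Suc n) \<omega> = sojourn X n \<omega> + sojourn_step X (Suc n) \<omega>"
  by (simp add: sojourn_def)

lemma sojourn_le: "sojourn X n \<omega> \<le> n"
  by (induction n) (auto simp: sojourn_def sojourn_step_def)

lemma walk_cong: "(\<And>j. j \<in> {1..n} \<Longrightarrow> X j \<omega> = Y j \<eta>) \<Longrightarrow> walk X n \<omega> = walk Y n \<eta>"
  by (simp add: walk_def)

text \<open>The two sample spaces may differ, so that \<open>X\<close> can be exchanged for the
  coordinate functions on a product space.\<close>

lemma sojourn_cong:
  assumes "\<And>j. j \<in> {1..n} \<Longrightarrow> X j \<omega> = Y j \<eta>"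
  shows "sojourn X n \<omega> = sojourn Y n \<eta>"
proof -
  have "walk X i \<omega> = walk Y i \<eta>" if "i \<le> n" for i
    using assms that by (intro walk_cong) auto
  then have "walk X i \<omega> = walk Y i \<eta>" "walk X (i - 1) \<omega> = walk Y (i - 1) \<eta>" if "i \<in> {1..n}" for i
    using that by auto
  then have "sojourn_step X i \<omega> = sojourn_step Y i \<eta>" if "i \<in> {1..n}" for i
    using that by (simp add: sojourn_step_def)
  then show ?thesis
    by (simp add: sojourn_def)
qed

lemma measurable_walk:
  assumes "\<And>j. j \<in> {1..n} \<Longrightarrow> X j \<in> measurable M (count_space UNIV)"
  shows "walk X n \<in> measurable M (count_space UNIV)"
  using assms
proof (induction n)
  case 0
  then show ?case by (simp add: walk_def)
next
  case (Suc n)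
  have [measurable]: "walk X n \<in> measurable M (count_space UNIV)"
    "X (Suc n) \<in> measurable M (count_space UNIV)"
    using Suc by auto
  show ?case unfolding walk_Suc[abs_def] by measurable
qed

lemma measurable_sojourn:
  assumes "\<And>j. j \<in> {1..n} \<Longrightarrow> X j \<in> measurable M (count_space UNIV)"
  shows "sojourn X n \<in> measurable M (count_space UNIV)"
  using assms
proof (induction n)
  case 0
  then show ?case by (simp add: sojourn_def)
next
  case (Suc n)
  have [measurable]: "walk X n \<in> measurable M (count_space UNIV)"
    "walk X (Suc n) \<in> measurable M (count_space UNIV)"
    "sojourn X n \<in> measurable M (count_space UNIV)"
    using Suc by (auto intro: measurable_walk)
  show ?case unfolding sojourn_Suc[abs_def] sojourn_step_def diff_Suc_1 by measurable
qed

text \<open>As a function of two positions, the increment is a constant once the end point and the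
  last step are fixed.\<close>

definition step_time :: "int \<Rightarrow> int \<Rightarrow> nat" where
  "step_time u v = (if v > 0 \<or> v = 0 \<and> u > 0 then 1 else 0)"

lemma sojourn_step_Suc: "sojourn_step X (Suc n) \<omega> = step_time (walk X n \<omega>) (walk X (Suc n) \<omega>)"
  by (simp add: sojourn_step_def step_time_def)

section \<open>One-step recursion for the joint law of position and sojourn time\<close>

locale bernoulli_walk = prob_space M for M :: "'a measure" +
  fixes X :: "nat \<Rightarrow> 'a \<Rightarrow> int" and p q :: real
  assumes pq: "q = 1 - p"
    and indep: "indep_vars (\<lambda>_. count_space UNIV) X {1..}"
    and prob_up: "\<And>j. j \<ge> 1 \<Longrightarrow> prob {\<omega> \<in> space M. X j \<omega> = 1} = p"
    and prob_down: "\<And>j. j \<ge> 1 \<Longrightarrow> prob {\<omega> \<in> space M. X j \<omega> = - 1} = q"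
begin

lemma measurable_X: "j \<ge> 1 \<Longrightarrow> X j \<in> measurable M (count_space UNIV)"
  using indep by (auto simp: indep_vars_def)

lemma measurable_walk_sojourn [measurable]:
  "walk X n \<in> measurable M (count_space UNIV)"
  "sojourn X n \<in> measurable M (count_space UNIV)"
  by (auto intro!: measurable_walk measurable_sojourn measurable_X)

lemma AE_step:
  assumes "j \<ge> 1"
  shows "AE \<omega> in M. X j \<omega> = 1 \<or> X j \<omega> = - 1"
proof -
  note [measurable] = measurable_X[OF assms]
  have "prob {\<omega> \<in> space M. X j \<omega> = 1 \<or> X j \<omega> = - 1} =
      prob {\<omega> \<in> space M. X j \<omega> = 1} + prob {\<omega> \<in> space M. X j \<omega> = - 1}"
    by (subst finite_measure_Union[symmetric]) (auto intro!: arg_cong[where f = prob])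
  also have "\<dots> = 1"
    using assms by (simp add: prob_up prob_down pq)
  finally show ?thesis
    by (subst (asm) prob_Collect_eq_1) auto
qed

lemma AE_walk_le: "AE \<omega> in M. walk X n \<omega> \<in> {- int n..int n}"
proof (induction n)
  case 0
  show ?case by (simp add: walk_def)
next
  case (Suc n)
  with AE_step[of "Suc n"] show ?case
    by (auto elim!: AE_mp simp: walk_Suc)
qed

text \<open>The blocks of steps \<open>{1..n}\<close> and \<open>{Suc n}\<close> are independent,
  and the event is a rectangle in the two blocks. The shift \<open>d\<close> stands for the sojourn
  increment of the last step.\<close>

lemma prob_past_step:
  assumes "e = 1 \<or> e = - 1"
  shows "prob {\<omega> \<in> space M. (walk X n \<omega> = s \<and> sojourn X n \<omega> + d = k) \<and> X (Suc n) \<omega> = e} =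
    prob {\<omega> \<in> space M. walk X n \<omega> = s \<and> sojourn X n \<omega> + d = k} *
    prob {\<omega> \<in> space M. X (Suc n) \<omega> = e}"
proof -
  let ?P = "PiM {1..n} (\<lambda>_. count_space UNIV :: int measure)"
  let ?Q = "PiM {Suc n} (\<lambda>_. count_space UNIV :: int measure)"
  \<comment> \<open>Evaluating the walk on the coordinate process expresses the past event as a set
    in the product space.\<close>
  let ?Z = "\<lambda>j (y :: nat \<Rightarrow> int). y j"
  have ind: "indep_var ?P (\<lambda>\<omega>. restrict (\<lambda>i. X i \<omega>) {1..n}) ?Q (\<lambda>\<omega>. restrict (\<lambda>i. X i \<omega>) {Suc n})"
    by (rule indep_var_restrict[OF indep]) auto
  have comp: "?Z j \<in> measurable ?P (count_space UNIV)" if "j \<in> {1..n}" for j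
    using that by (rule measurable_component_singleton)
  have [measurable]: "walk ?Z n \<in> measurable ?P (count_space UNIV)"
    "sojourn ?Z n \<in> measurable ?P (count_space UNIV)"
    by (auto intro!: measurable_walk measurable_sojourn comp)
  have [measurable]: "?Z (Suc n) \<in> measurable ?Q (count_space UNIV)"
    by (rule measurable_component_singleton) simp
  let ?A = "{y \<in> space ?P. walk ?Z n y = s \<and> sojourn ?Z n y + d = k}"
  let ?B = "{y \<in> space ?Q. ?Z (Suc n) y = e}"
  have eqs: "walk ?Z n (restrict (\<lambda>i. X i \<omega>) {1..n}) = walk X n \<omega>"
    "sojourn ?Z n (restrict (\<lambda>i. X i \<omega>) {1..n}) = sojourn X n \<omega>" for \<omega>
    by (rule walk_cong sojourn_cong; simp)+
  have sp: "restrict (\<lambda>i. X i \<omega>) I \<in> space (PiM I (\<lambda>_. count_space UNIV))" for I \<omega>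
    by (simp add: space_PiM)
  have "prob ((\<lambda>x. (restrict (\<lambda>i. X i x) {1..n}, restrict (\<lambda>i. X i x) {Suc n})) -` (?A \<times> ?B) \<inter> space M) =
      prob ((\<lambda>\<omega>. restrict (\<lambda>i. X i \<omega>) {1..n}) -` ?A \<inter> space M) *
      prob ((\<lambda>\<omega>. restrict (\<lambda>i. X i \<omega>) {Suc n}) -` ?B \<inter> space M)"
    by (rule indep_varD[OF ind]) measurable
  moreover have "(\<lambda>x. (restrict (\<lambda>i. X i x) {1..n}, restrict (\<lambda>i. X i x) {Suc n})) -` (?A \<times> ?B) \<inter> space M =
      {\<omega> \<in> space M. (walk X n \<omega> = s \<and> sojourn X n \<omega> + d = k) \<and> X (Suc n) \<omega> = e}"
    using sp by (auto simp: eqs simp del: One_nat_def)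
  moreover have "(\<lambda>\<omega>. restrict (\<lambda>i. X i \<omega>) {1..n}) -` ?A \<inter> space M =
      {\<omega> \<in> space M. walk X n \<omega> = s \<and> sojourn X n \<omega> + d = k}"
    using sp by (auto simp: eqs simp del: One_nat_def)
  moreover have "(\<lambda>\<omega>. restrict (\<lambda>i. X i \<omega>) {Suc n}) -` ?B \<inter> space M = {\<omega> \<in> space M. X (Suc n) \<omega> = e}"
    using sp by auto
  ultimately show ?thesis by simp
qed

definition joint_prob :: "nat \<Rightarrow> int \<Rightarrow> nat \<Rightarrow> real" where
  "joint_prob n s k = prob {\<omega> \<in> space M. walk X n \<omega> = s \<and> sojourn X n \<omega> = k}"

lemma joint_prob_0: "joint_prob 0 s k = (if s = 0 \<and> k = 0 then 1 else 0)"
  by (auto simp: joint_prob_def walk_def sojourn_def prob_space)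

lemma joint_prob_eq_0:
  assumes "n < k"
  shows "joint_prob n s k = 0"
proof -
  have "sojourn X n \<omega> \<noteq> k" for \<omega>
    using assms sojourn_le[of X n \<omega>] by simp
  then show ?thesis
    by (simp add: joint_prob_def)
qed

text \<open>The increment is added to the sojourn time rather than subtracted from \<open>k\<close>,
  which avoids truncation at \<open>k = 0\<close>.\<close>

lemma joint_prob_Suc:
  "joint_prob (Suc n) s k =
    p * prob {\<omega> \<in> space M. walk X n \<omega> = s - 1 \<and> sojourn X n \<omega> + step_time (s - 1) s = k} +
    q * prob {\<omega> \<in> space M. walk X n \<omega> = s + 1 \<and> sojourn X n \<omega> + step_time (s + 1) s = k}"
proof -
  note [measurable] = measurable_X[of "Suc n", simplified]
  let ?E = "\<lambda>e. {\<omega> \<in> space M. (walk X n \<omega> = s - e \<and> sojourn X n \<omega> + step_time (s - e) s = k) \<and> X (Suc n) \<omega> = e}"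
  have "joint_prob (Suc n) s k = prob (?E 1 \<union> ?E (- 1))"
    unfolding joint_prob_def
  proof (rule measure_eq_AE)
    show "AE \<omega> in M. (\<omega> \<in> {\<omega> \<in> space M. walk X (Suc n) \<omega> = s \<and> sojourn X (Suc n) \<omega> = k}) =
        (\<omega> \<in> ?E 1 \<union> ?E (- 1))"
      using AE_step[of "Suc n"]
      by (rule AE_mp) (auto simp: sojourn_Suc sojourn_step_Suc walk_Suc)
  qed auto
  also have "\<dots> = prob (?E 1) + prob (?E (- 1))"
    by (rule finite_measure_Union) auto
  finally show ?thesis
    using prob_past_step[of 1 n "s - 1" "step_time (s - 1) s" k]
      prob_past_step[of "- 1" n "s + 1" "step_time (s + 1) s" k]
    by (simp add: prob_up prob_down mult.commute)
qed

lemma joint_prob_Suc_pos: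
  assumes "s > 0"
  shows "joint_prob (Suc n) s 0 = 0"
    and "joint_prob (Suc n) s (Suc k) = p * joint_prob n (s - 1) k + q * joint_prob n (s + 1) k"
  using assms by (simp_all add: joint_prob_Suc step_time_def) (simp add: joint_prob_def)

lemma joint_prob_Suc_neg:
  "s < 0 \<Longrightarrow> joint_prob (Suc n) s k = p * joint_prob n (s - 1) k + q * joint_prob n (s + 1) k"
  by (simp add: joint_prob_Suc step_time_def) (simp add: joint_prob_def)

text \<open>A step into 0 counts according to its origin: only arrivals from 1 raise the sojourn
  time.\<close>

lemma joint_prob_Suc_0:
  "joint_prob (Suc n) 0 k = p * joint_prob n (- 1) k + (if k = 0 then 0 else q * joint_prob n 1 (k - 1))"
  by (cases k) (simp_all add: joint_prob_Suc step_time_def, simp_all add: joint_prob_def)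

text \<open>Both sides have the same initial values and the same one-step recursion. Negative end
  points are handled by reflecting the path.\<close>

lemma joint_prob_eq:
  "k \<le> n \<Longrightarrow> joint_prob n s k =
    (if s \<ge> 0 then path_weight p q k (n - k) (nat s) else path_weight q p (n - k) k (nat (- s)))"
proof (induction n arbitrary: s k)
  case 0
  have "path_weight p q 0 0 (nat s) = (if s = 0 then 1 else 0)" if "s \<ge> 0" for p q :: real and s
    using that by (simp add: path_weight_def bridge_def cat_weight_def catalan_def)
  from this[of s p q] this[of "- s" q p] 0 show ?case
    by (auto simp: joint_prob_0)
next
  case (Suc n)
  consider "s > 0" | "s < 0" | "s = 0" by linarith
  then show ?case
  proof cases
    case 1
    then obtain t where s: "s = int (Suc t)" by (metis zero_less_imp_eq_int gr0_implies_Suc)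
    have 2: "nat (s - 1) = t" "nat (s + 1) = t + 2" "nat s = Suc t" by (auto simp: s)
    show ?thesis
    proof (cases k)
      case 0
      with 1 2 show ?thesis by (simp add: joint_prob_Suc_pos path_weight_0_Suc)
    next
      case (Suc k')
      with 1 2 Suc.IH[of k'] \<open>k \<le> Suc n\<close> show ?thesis
        by (simp add: joint_prob_Suc_pos path_weight_Suc_Suc)
    qed
  next
    case 2
    then obtain t where s: "s = - int (Suc t)" by (metis zero_less_imp_eq_int gr0_implies_Suc neg_0_less_iff_less minus_minus)
    have 3: "nat (- (s - 1)) = t + 2" "nat (- (s + 1)) = t" "nat (- s) = Suc t" by (auto simp: s)
    show ?thesis
    proof (cases "k = Suc n")
      case True
      with 2 3 show ?thesis by (simp add: joint_prob_Suc_neg joint_prob_eq_0 path_weight_0_Suc)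
    next
      case False
      with \<open>k \<le> Suc n\<close> have k: "k \<le> n" "Suc n - k = Suc (n - k)" by auto
      \<comment> \<open>If \<open>t = 0\<close>, then \<open>s + 1\<close> is 0 and the hypothesis
        gives the nonnegative branch; the branches agree there by symmetry of
        \<open>bridge\<close>.\<close>
      have 4: "joint_prob n (s + 1) k = path_weight q p (n - k) k t"
        using 2 3 Suc.IH[OF k(1), of "s + 1"]
        by (auto simp: path_weight_0 bridge_commute mult.commute not_le[symmetric])
      have 5: "joint_prob n (s - 1) k = path_weight q p (n - k) k (t + 2)"
        using 2 3 Suc.IH[OF k(1), of "s - 1"] by simp
      show ?thesis
        using 2 3 by (simp add: joint_prob_Suc_neg 4 5 k path_weight_Suc_Suc)
    qed
  next
    case 3
    have 1: "joint_prob n (- 1) k = (if k = Suc n then 0 else path_weight q p (n - k) k 1)"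
      using Suc.IH[of k "- 1"] \<open>k \<le> Suc n\<close> by (auto simp: joint_prob_eq_0)
    have 2: "joint_prob n 1 (k - 1) = path_weight p q (k - 1) (Suc n - k) 1" if "k \<noteq> 0"
      using Suc.IH[of "k - 1" 1] \<open>k \<le> Suc n\<close> that by simp
    have "bridge (p * q) k (Suc n - k) =
      (if k = 0 then 0 else q * path_weight p q (k - 1) (Suc n - k) 1) +
      (if Suc n - k = 0 then 0 else p * path_weight q p (Suc n - k - 1) k 1)"
      \<comment> \<open>The two summands are exactly the arrivals at 0 from above and from
        below.\<close>
      by (rule bridge_last_step) (use \<open>k \<le> Suc n\<close> in auto)
    with 3 1 2 \<open>k \<le> Suc n\<close> show ?thesis
      by (auto simp: joint_prob_Suc_0 path_weight_0)
  qed
qed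

section \<open>Summing the joint law over positive or negative end points\<close>

lemma prob_sojourn_walk_in:
  assumes "I \<subseteq> {- int n..int n}" and I: "\<And>s. s \<in> {- int n..int n} \<Longrightarrow> s \<in> I \<longleftrightarrow> P s"
  shows "prob {\<omega> \<in> space M. sojourn X n \<omega> = k \<and> P (walk X n \<omega>)} = (\<Sum>s\<in>I. joint_prob n s k)"
proof -
  let ?E = "\<lambda>s. {\<omega> \<in> space M. walk X n \<omega> = s \<and> sojourn X n \<omega> = k}"
  have fin: "finite I" using assms(1) finite_subset by blast
  have "prob {\<omega> \<in> space M. sojourn X n \<omega> = k \<and> P (walk X n \<omega>)} = prob (\<Union>s\<in>I. ?E s)"
  proof (rule measure_eq_AE)
    \<comment> \<open>The end point lies between \<open>- int n\<close> and \<open>int n\<close>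
      almost surely, so \<open>I\<close> has to match \<open>P\<close> on that range only.\<close>
    show "AE \<omega> in M. (\<omega> \<in> {\<omega> \<in> space M. sojourn X n \<omega> = k \<and> P (walk X n \<omega>)}) = (\<omega> \<in> (\<Union>s\<in>I. ?E s))"
      using AE_walk_le[of n] by (rule AE_mp) (use I in auto)
  qed (use fin in auto)
  also have "\<dots> = (\<Sum>s\<in>I. prob (?E s))"
    by (rule finite_measure_finite_Union) (auto simp: fin disjoint_family_on_def)
  finally show ?thesis by (simp add: joint_prob_def)
qed

lemma r_plus_eq:
  assumes "k \<le> n"
  shows "r_plus M X k n = (\<Sum>s=1..n. path_weight p q k (n - k) s)"
proof -
  have "r_plus M X k n = (\<Sum>s\<in>{1..int n}. joint_prob n s k)"
    unfolding r_plus_def by (rule prob_sojourn_walk_in) auto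
  also have "\<dots> = (\<Sum>s=1..n. path_weight p q k (n - k) s)"
    by (rule sum.reindex_bij_witness[of _ int nat]) (auto simp: joint_prob_eq assms)
  finally show ?thesis .
qed

lemma r_minus_eq:
  assumes "k \<le> n"
  shows "r_minus M X k n = (\<Sum>s=1..n. path_weight q p (n - k) k s)"
proof -
  have "r_minus M X k n = (\<Sum>s\<in>{- int n..-1}. joint_prob n s k)"
    unfolding r_minus_def by (rule prob_sojourn_walk_in) auto
  also have "\<dots> = (\<Sum>s=1..n. path_weight q p (n - k) k s)"
    by (rule sum.reindex_bij_witness[of _ "\<lambda>s. - int s" "\<lambda>s. nat (- s)"]) (auto simp: joint_prob_eq assms)
  finally show ?thesis .
qed

end

(* The bounds i \<le> n - 1, i \<le> n - 2 and j \<le> i + k - n are written without subtraction,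
   which truncates on nat (the difference matters for n < 2). *)
theorem theorem7p3:
  fixes M :: "'a measure" and X :: "nat \<Rightarrow> 'a \<Rightarrow> int" and p q :: real and k n :: nat
  assumes "prob_space M"
    and "0 < p" and "p < 1" and "q = 1 - p"
    and "prob_space.indep_vars M (\<lambda>_. count_space UNIV) X {1..}"
    and "\<And>j. j \<ge> 1 \<Longrightarrow> measure M {\<omega> \<in> space M. X j \<omega> = 1} = p"
    and "\<And>j. j \<ge> 1 \<Longrightarrow> measure M {\<omega> \<in> space M. X j \<omega> = - 1} = q"
    and "k \<le> n"
  shows "r_plus M X k n =
           indicator evens (n - k) *
             (2 * p * (\<Sum>i\<in>{i\<in>evens. n - k \<le> i \<and> i + 1 \<le> n}. a_coeff i * (p * q) ^ (i div 2))
              - 4 * (\<Sum>i\<in>{i\<in>evens. n - k \<le> i \<and> i + 2 \<le> n}.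
                  (\<Sum>j\<in>{j\<in>evens. j + n \<le> i + k}. a_coeff j * a_coeff (i - j))
                    * (p * q) ^ (i div 2 + 1)))
       \<and> r_minus M X k n =
           indicator evens k *
             (2 * q * (\<Sum>i\<in>{i\<in>evens. k \<le> i \<and> i + 1 \<le> n}. a_coeff i * (p * q) ^ (i div 2))
              - 4 * (\<Sum>i\<in>{i\<in>evens. k \<le> i \<and> i + 2 \<le> n}.
                  (\<Sum>j\<in>{j\<in>evens. j + k \<le> i}. a_coeff j * a_coeff (i - j))
                    * (p * q) ^ (i div 2 + 1)))"
proof -
  interpret bernoulli_walk M X p q
    using assms by (simp add: bernoulli_walk_def bernoulli_walk_axioms_def)
  have "j + n \<le> i + k \<longleftrightarrow> j + (n - k) \<le> i" for i j
    using \<open>k \<le> n\<close> by auto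
  moreover have "r_plus M X k n = (\<Sum>s=1..n. path_weight p q k (n - k) s)"
    "r_minus M X k n = (\<Sum>s=1..n. path_weight q p (n - k) k s)"
    using \<open>k \<le> n\<close> by (rule r_plus_eq, rule r_minus_eq)
  ultimately show ?thesis
    using sum_path_weight[of q p n k "n - k"] sum_path_weight[of p q n "n - k" k, unfolded mult.commute[of q p]]
      \<open>k \<le> n\<close> \<open>q = 1 - p\<close>
    by simp
qed

end
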